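(* Let $\mathcal{C}$ be a context-free language over an alphabet of $k$ letters $Z_1,\dots,Z_k$ with weighted generating function $C_{\boldsymbol{\pi}}(z)$, let $\boldsymbol{a}\in\mathbb{R}_{>0}^k$ and $n$ be given, and let $x_n$ and $\boldsymbol{\pi}_{\boldsymbol{a}}$ be the solution of $\mathbb{E}_{x,\boldsymbol{\pi}}(N)=n$ and $\mathbb{E}_{x,\boldsymbol{\pi}}(N_i)=a_i$ for all $i$. Assume that, as $n\to\infty$, the random vectors $U_n(\boldsymbol{\pi}_{\boldsymbol{a}})$ admit as limiting distribution a multidimensional Gaussian law with mean $\boldsymbol{\mu}$ and variance-covariance matrix $\boldsymbol{V}$ proportional to $f(n)$. Then the exact-composition rejection sampler with parameters $x_n,\boldsymbol{\pi}_{\boldsymbol{a}}$ succeeds after an expected number of trials equal (asymptotically) to $(2\pi)^{k/2}(\det \boldsymbol{V})^{1/2}=\Theta(f(n)^{k/2})$.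
   Context: Weights $\boldsymbol{\pi}=(\pi_1,\dots,\pi_k)>0$; a word $w$ has weight $\pi(w)=\prod_i\pi_i^{|w|_{Z_i}}$ and $C_{\boldsymbol{\pi}}(z)=\sum_{w\in\mathcal{C}}\pi(w)z^{|w|}$. The weighted Boltzmann distribution with parameter $x$ draws $w\in\mathcal{C}$ with probability $\pi(w)x^{|w|}/C_{\boldsymbol{\pi}}(x)$; $N$ denotes the length and $N_i$ the number of occurrences of $Z_i$ of the drawn word, with expectations $\mathbb{E}_{x,\boldsymbol{\pi}}(N)$, $\mathbb{E}_{x,\boldsymbol{\pi}}(N_i)$. For words of length exactly $n$, $U_n(\boldsymbol{\pi}_0)$ is the random vector of letter counts under the $\boldsymbol{\pi}_0$-weighted distribution on words of length $n$: $\mathbb{P}(U_n(\boldsymbol{\pi}_0)=\boldsymbol{a})=\boldsymbol{\pi}_0^{\boldsymbol{a}}[z^n\boldsymbol{\pi}^{\boldsymbol{a}}]C_{\boldsymbol{\pi}}(z)/[z^n]C_{\boldsymbol{\pi}_0}(z)$; its mean is $\boldsymbol{\mu}$ and covariance matrix $\boldsymbol{V}$. A trial consists of drawing from the weighted Boltzmann distribution (parameter $x_n$, weights $\boldsymbol{\pi}_{\boldsymbol{a}}$) repeatedly until a word of length exactly $n$ is obtained; the exact-composition rejection sampler repeats trials until the letter-count vector of the obtained word equals the targeted (mean) composition $\boldsymbol{\mu}$, and returns it.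
   Formalization: Beyond the Gaussian limit, point probabilities of U_n are assumed asymptotically equicontinuous near μ (else (aa|b)* is a counterexample); V/f(n) has an invertible limit; the target is any integer vector within 1 of μ per coordinate; extra letters of weight 1 are allowed. *)

theory Defs
  imports "HOL-Probability.Probability" "HOL-Library.Landau_Symbols"
begin

subsection \<open>Context-free languages\<close>

text \<open>Nonterminals are natural numbers, which is no restriction because a grammar has only
  finitely many productions. Sentential forms are lists of nonterminals (\<open>Inl\<close>) and
  letters (\<open>Inr\<close>).\<close>

definition cfg_step :: "(nat \<times> (nat + 'a) list) set \<Rightarrow> (nat + 'a) list \<Rightarrow> (nat + 'a) list \<Rightarrow> bool" where
  "cfg_step P u v \<longleftrightarrow>
     (\<exists>l r A \<gamma>. (A, \<gamma>) \<in> P \<and> u = l @ [Inl A] @ r \<and> v = l @ \<gamma> @ r)"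

definition context_free :: "'a list set \<Rightarrow> bool" where
  "context_free L \<longleftrightarrow>
     (\<exists>P S. finite P \<and> L = {w. (cfg_step P)\<^sup>*\<^sup>* [Inl S] (map Inr w)})"


subsection \<open>Weighted words\<close>

text \<open>The map \<open>Z\<close> enumerates the \<open>k = CARD('k)\<close> weighted letters \<open>Z\<^sub>1, \<dots>, Z\<^sub>k\<close>. It is required
  to be injective wherever it is used, but not surjective: the alphabet \<open>'a\<close> may contain further
  letters, which contribute to the length and have weight 1.\<close>

definition letter_counts :: "('k \<Rightarrow> 'a) \<Rightarrow> 'a list \<Rightarrow> nat ^ 'k" where
  "letter_counts Z w = (\<chi> i. count_list w (Z i))"

definition weight :: "('k::finite \<Rightarrow> 'a) \<Rightarrow> real ^ 'k \<Rightarrow> 'a list \<Rightarrow> real" where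
  "weight Z \<pi> w = (\<Prod>i\<in>UNIV. (\<pi> $ i) ^ count_list w (Z i))"

definition gen_fun :: "'a list set \<Rightarrow> ('k::finite \<Rightarrow> 'a) \<Rightarrow> real ^ 'k \<Rightarrow> real \<Rightarrow> real" where
  "gen_fun L Z \<pi> z = (\<Sum>\<^sub>\<infinity>w\<in>L. weight Z \<pi> w * z ^ length w)"

definition boltzmann ::
    "'a list set \<Rightarrow> ('k::finite \<Rightarrow> 'a) \<Rightarrow> real ^ 'k \<Rightarrow> real \<Rightarrow> 'a list pmf" where
  "boltzmann L Z \<pi> x =
     embed_pmf (\<lambda>w. if w \<in> L then weight Z \<pi> w * x ^ length w / gen_fun L Z \<pi> x else 0)"

text \<open>The parameters \<open>x, \<pi>\<close> solve the system \<open>E(N) = n\<close>, \<open>E(N\<^sub>i) = a\<^sub>i\<close>. Summability says that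
  the Boltzmann distribution exists. Since a Bochner integral of a non-integrable function is 0,
  the equations force finite expectations whenever \<open>n\<close> and the \<open>a\<^sub>i\<close> are positive.\<close>

definition tuned ::
    "'a list set \<Rightarrow> ('k::finite \<Rightarrow> 'a) \<Rightarrow> nat \<Rightarrow> real ^ 'k \<Rightarrow> real \<Rightarrow> real ^ 'k \<Rightarrow> bool" where
  "tuned L Z n a x \<pi> \<longleftrightarrow>
     0 < x \<and> (\<forall>i. 0 < \<pi> $ i) \<and>
     (\<lambda>w. weight Z \<pi> w * x ^ length w) summable_on L \<and>
     measure_pmf.expectation (boltzmann L Z \<pi> x) (\<lambda>w. real (length w)) = real n \<and>
     (\<forall>i. measure_pmf.expectation (boltzmann L Z \<pi> x) (\<lambda>w. real (count_list w (Z i))) = a $ i)"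


subsection \<open>Words of a fixed length\<close>

definition words_of_length :: "'a list set \<Rightarrow> nat \<Rightarrow> 'a list set" where
  "words_of_length L n = {w \<in> L. length w = n}"

text \<open>The limit \<open>n \<longrightarrow> \<infinity>\<close> is taken along the lengths that occur in the language.\<close>

definition lengths_at_top :: "'a list set \<Rightarrow> nat filter" where
  "lengths_at_top L = inf sequentially (principal {n. words_of_length L n \<noteq> {}})"

definition fixed_length_pmf ::
    "'a list set \<Rightarrow> ('k::finite \<Rightarrow> 'a) \<Rightarrow> real ^ 'k \<Rightarrow> nat \<Rightarrow> 'a list pmf" where
  "fixed_length_pmf L Z \<pi> n =
     embed_pmf (\<lambda>w. if w \<in> words_of_length L n
                    then weight Z \<pi> w / (\<Sum>v\<in>words_of_length L n. weight Z \<pi> v) else 0)"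

text \<open>The law of the random vector \<open>U\<^sub>n(\<pi>)\<close>; see \<open>pmf_count_law\<close> below for its coefficient form.\<close>

definition count_law ::
    "'a list set \<Rightarrow> ('k::finite \<Rightarrow> 'a) \<Rightarrow> real ^ 'k \<Rightarrow> nat \<Rightarrow> (nat ^ 'k) pmf" where
  "count_law L Z \<pi> n = map_pmf (letter_counts Z) (fixed_length_pmf L Z \<pi> n)"


subsection \<open>Gaussian limits of random vectors of natural numbers\<close>

definition rvec :: "nat ^ 'k \<Rightarrow> real ^ 'k" where
  "rvec m = (\<chi> i. real (m $ i))"

definition mean_vec :: "(nat ^ 'k::finite) pmf \<Rightarrow> real ^ 'k" where
  "mean_vec U = (\<chi> i. measure_pmf.expectation U (\<lambda>m. real (m $ i)))"

definition cov_mat :: "(nat ^ 'k::finite) pmf \<Rightarrow> real ^ 'k ^ 'k" where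
  "cov_mat U =
     (\<chi> i j. measure_pmf.expectation U
               (\<lambda>m. (real (m $ i) - mean_vec U $ i) * (real (m $ j) - mean_vec U $ j)))"

definition gaussian :: "real ^ 'k::finite ^ 'k \<Rightarrow> (real ^ 'k) measure" where
  "gaussian V =
     density lborel
       (\<lambda>y. ennreal (exp (- (y \<bullet> (matrix_inv V *v y)) / 2) /
                     ((2 * pi) powr (real CARD('k) / 2) * sqrt (det V))))"

text \<open>Convergence in distribution of \<open>(U\<^sub>n - \<mu>\<^sub>n) / f(n)\<^sup>1\<^sup>/\<^sup>2\<close> to the centred Gaussian law with
  covariance matrix \<open>V\<close>, tested on bounded continuous functions.\<close>

definition gaussian_limit ::
    "nat filter \<Rightarrow> (nat \<Rightarrow> (nat ^ 'k::finite) pmf) \<Rightarrow> (nat \<Rightarrow> real) \<Rightarrow> real ^ 'k ^ 'k \<Rightarrow> bool" where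
  "gaussian_limit F U f V \<longleftrightarrow>
     (\<forall>g :: real ^ 'k \<Rightarrow> real. continuous_on UNIV g \<and> bounded (range g) \<longrightarrow>
        ((\<lambda>n. measure_pmf.expectation (U n)
                 (\<lambda>m. g ((1 / sqrt (f n)) *\<^sub>R (rvec m - mean_vec (U n)))))
           \<longlongrightarrow> (LINT y|gaussian V. g y)) F)"

text \<open>Convergence in distribution says nothing about single points; for instance, \<open>U\<^sub>n\<close> could be
  carried by a sublattice. This condition excludes such local irregularities near the mean: on the
  scale \<open>f(n)\<^sup>-\<^sup>k\<^sup>/\<^sup>2\<close> of a Gaussian density, the point probabilities are asymptotically
  equicontinuous there. It does not mention the value of the limit.\<close>

definition locally_regular ::
    "nat filter \<Rightarrow> (nat \<Rightarrow> (nat ^ 'k::finite) pmf) \<Rightarrow> (nat \<Rightarrow> real) \<Rightarrow> bool" where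
  "locally_regular F U f \<longleftrightarrow>
     (\<forall>\<epsilon>>0. \<exists>\<delta>>0. \<forall>\<^sub>F n in F. \<forall>m m'.
        norm (rvec m - mean_vec (U n)) \<le> \<delta> * sqrt (f n) \<and>
        norm (rvec m' - mean_vec (U n)) \<le> \<delta> * sqrt (f n) \<longrightarrow>
        f n powr (real CARD('k) / 2) * \<bar>pmf (U n) m - pmf (U n) m'\<bar> \<le> \<epsilon>)"


subsection \<open>The rejection sampler\<close>

text \<open>The sampler consumes an infinite sequence \<open>\<omega>\<close> of independent draws. Each draw of length \<open>n\<close>
  ends one trial, and the sampler stops at the first draw that also has composition \<open>t\<close>. So the
  number of trials is the number of draws of length \<open>n\<close> up to and including that one.\<close>

definition accepts :: "('k \<Rightarrow> 'a) \<Rightarrow> nat \<Rightarrow> nat ^ 'k \<Rightarrow> 'a list \<Rightarrow> bool" where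
  "accepts Z n t w \<longleftrightarrow> length w = n \<and> letter_counts Z w = t"

definition num_trials :: "('k \<Rightarrow> 'a) \<Rightarrow> nat \<Rightarrow> nat ^ 'k \<Rightarrow> (nat \<Rightarrow> 'a list) \<Rightarrow> ennreal" where
  "num_trials Z n t \<omega> =
     (if \<exists>j. accepts Z n t (\<omega> j)
      then of_nat (card {j. j \<le> (LEAST j. accepts Z n t (\<omega> j)) \<and> length (\<omega> j) = n})
      else \<infinity>)"

definition expected_trials ::
    "'a list set \<Rightarrow> ('k::finite \<Rightarrow> 'a) \<Rightarrow> real ^ 'k \<Rightarrow> real \<Rightarrow> nat \<Rightarrow> nat ^ 'k \<Rightarrow> ennreal" where
  "expected_trials L Z \<pi> x n t =
     (\<integral>\<^sup>+ \<omega>. num_trials Z n t \<omega> \<partial>(\<Pi>\<^sub>M j\<in>(UNIV :: nat set). measure_pmf (boltzmann L Z \<pi> x)))"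


subsection \<open>The probability mass functions\<close>

lemma weight_pos:
  assumes "\<forall>i. 0 < \<pi> $ i"
  shows "0 < weight Z \<pi> w"
  using assms by (auto simp: weight_def intro!: prod_pos)

lemma finite_words_of_length:
  fixes L :: "'a::finite list set"
  shows "finite (words_of_length L n)"
proof (rule finite_subset)
  show "words_of_length L n \<subseteq> {w. set w \<subseteq> UNIV \<and> length w = n}"
    by (auto simp: words_of_length_def)
  show "finite {w :: 'a list. set w \<subseteq> UNIV \<and> length w = n}"
    by (rule finite_lists_length_eq) simp
qed

lemma pmf_boltzmann:
  assumes x: "0 < x" and \<pi>: "\<forall>i. 0 < \<pi> $ i"
    and sm: "(\<lambda>w. weight Z \<pi> w * x ^ length w) summable_on L" and ne: "L \<noteq> {}"
  shows "pmf (boltzmann L Z \<pi> x) w =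
           (if w \<in> L then weight Z \<pi> w * x ^ length w / gen_fun L Z \<pi> x else 0)"
proof -
  let ?h = "\<lambda>w. weight Z \<pi> w * x ^ length w"
  let ?G = "gen_fun L Z \<pi> x"
  have hpos: "0 < ?h w" for w
    using weight_pos[OF \<pi>, of Z w] x by simp
  obtain v where v: "v \<in> L" using ne by blast
  have "infsum ?h {v} \<le> infsum ?h L"
    using sm v hpos by (intro infsum_mono_neutral) (auto intro: less_imp_le)
  then have G: "0 < ?G"
    using hpos[of v] by (simp add: gen_fun_def)
  have nonneg: "0 \<le> ?h w / ?G" for w
    using hpos[of w] G by (rule divide_nonneg_pos[OF less_imp_le])
  have "(\<integral>\<^sup>+ w. ennreal (if w \<in> L then ?h w / ?G else 0) \<partial>count_space UNIV)
        = (\<integral>\<^sup>+ w. ennreal (?h w / ?G) \<partial>count_space L)"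
    by (subst nn_integral_count_space_indicator)
       (auto intro!: nn_integral_cong simp: indicator_def)
  also have "\<dots> = ennreal (infsum (\<lambda>w. ?h w / ?G) L)"
  proof (subst nn_integral_conv_infsetsum)
    have s: "(\<lambda>w. ?h w / ?G) summable_on L"
      using summable_on_cmult_left[OF sm, of "1 / ?G"] by simp
    have as: "(\<lambda>w. norm (?h w / ?G)) summable_on L"
      by (rule summable_on_iff_abs_summable_on_real[THEN iffD1, OF s])
    then show abs: "Infinite_Set_Sum.abs_summable_on (\<lambda>w. ?h w / ?G) L"
      by (rule abs_summable_equivalent[THEN iffD1])
    show "ennreal (infsetsum (\<lambda>w. ?h w / ?G) L) = ennreal (infsum (\<lambda>w. ?h w / ?G) L)"
      using abs by (simp add: infsetsum_infsum)
    show "\<And>w. w \<in> L \<Longrightarrow> 0 \<le> ?h w / ?G"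
      by (rule nonneg)
  qed
  also have "infsum (\<lambda>w. ?h w / ?G) L = 1"
    using infsum_cmult_left[of "1 / ?G" ?h L] sm G by (simp add: gen_fun_def)
  finally have one: "(\<integral>\<^sup>+ w. ennreal (if w \<in> L then ?h w / ?G else 0) \<partial>count_space UNIV) = 1"
    by simp
  show ?thesis
    unfolding boltzmann_def
    by (rule pmf_embed_pmf[OF _ one]) (metis nonneg order.refl)
qed

lemma pmf_fixed_length:
  fixes L :: "'a::finite list set"
  assumes \<pi>: "\<forall>i. 0 < \<pi> $ i" and ne: "words_of_length L n \<noteq> {}"
  shows "pmf (fixed_length_pmf L Z \<pi> n) w =
           (if w \<in> words_of_length L n
            then weight Z \<pi> w / (\<Sum>v\<in>words_of_length L n. weight Z \<pi> v) else 0)"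
proof -
  let ?W = "words_of_length L n"
  let ?G = "\<Sum>v\<in>?W. weight Z \<pi> v"
  have fin: "finite ?W" by (rule finite_words_of_length)
  have G: "0 < ?G"
    using fin ne by (intro sum_pos weight_pos[OF \<pi>]) auto
  have "(\<integral>\<^sup>+ w. ennreal (if w \<in> ?W then weight Z \<pi> w / ?G else 0) \<partial>count_space UNIV)
        = (\<integral>\<^sup>+ w. ennreal (weight Z \<pi> w / ?G) \<partial>count_space ?W)"
    by (subst nn_integral_count_space_indicator)
       (auto intro!: nn_integral_cong simp: indicator_def)
  also have "\<dots> = (\<Sum>w\<in>?W. ennreal (weight Z \<pi> w / ?G))"
    using fin by (rule nn_integral_count_space_finite)
  also have "\<dots> = ennreal (\<Sum>w\<in>?W. weight Z \<pi> w / ?G)"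
    using G by (intro sum_ennreal) (simp add: weight_pos[OF \<pi>] less_imp_le)
  also have "(\<Sum>w\<in>?W. weight Z \<pi> w / ?G) = 1"
    using G by (simp flip: sum_divide_distrib)
  finally have one: "(\<integral>\<^sup>+ w. ennreal (if w \<in> ?W then weight Z \<pi> w / ?G else 0) \<partial>count_space UNIV) = 1"
    by simp
  show ?thesis
    unfolding fixed_length_pmf_def
    by (rule pmf_embed_pmf[OF _ one]) (use G in \<open>simp add: weight_pos[OF \<pi>] less_imp_le\<close>)
qed

text \<open>The coefficient of \<open>z\<^sup>n \<pi>\<^sup>m\<close> in the generating function is the number of words of length \<open>n\<close>
  and composition \<open>m\<close>, and the coefficient of \<open>z\<^sup>n\<close> is the total weight of the words of length
  \<open>n\<close>.\<close>

lemma pmf_count_law: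
  fixes L :: "'a::finite list set"
  assumes \<pi>: "\<forall>i. 0 < \<pi> $ i" and ne: "words_of_length L n \<noteq> {}"
  shows "pmf (count_law L Z \<pi> n) m =
           (\<Prod>i\<in>UNIV. (\<pi> $ i) ^ (m $ i)) *
           real (card {w \<in> words_of_length L n. letter_counts Z w = m}) /
           (\<Sum>v\<in>words_of_length L n. weight Z \<pi> v)"
proof -
  let ?W = "words_of_length L n"
  let ?A = "{w \<in> ?W. letter_counts Z w = m}"
  let ?p = "fixed_length_pmf L Z \<pi> n"
  let ?G = "\<Sum>v\<in>?W. weight Z \<pi> v"
  have fin: "finite ?W" by (rule finite_words_of_length)
  have supp: "set_pmf ?p \<subseteq> ?W"
    by (auto simp: set_pmf_eq pmf_fixed_length[OF \<pi> ne])
  have "pmf (count_law L Z \<pi> n) m = measure_pmf.prob ?p (letter_counts Z -` {m})"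
    by (simp add: count_law_def pmf_map)
  also have "\<dots> = measure_pmf.prob ?p ?A"
    by (rule measure_prob_cong_0) (use supp in \<open>auto simp: set_pmf_iff\<close>)
  also have "\<dots> = (\<Sum>w\<in>?A. pmf ?p w)"
    using fin by (intro measure_measure_pmf_finite) simp
  also have "\<dots> = (\<Sum>w\<in>?A. (\<Prod>i\<in>UNIV. (\<pi> $ i) ^ (m $ i)) / ?G)"
    by (intro sum.cong)
       (auto simp: pmf_fixed_length[OF \<pi> ne] weight_def letter_counts_def)
  finally show ?thesis by simp
qed

end

(* By independence, a draw of length n ends the run with conditional probability P(U_n = t), so the
   expected number of trials is 1 / P(U_n = t), and everything rests on a local limit theorem at the
   mean. The Gaussian limit gives the mass of a small cube of side 2 r sqrt(f) around the mean;
   the cube contains asymptotically (2 r sqrt(f))^k lattice points, because f tends to infinity and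
   the mean stays far from the boundary of the orthant, and by local regularity these points
   have nearly equal probabilities. Hence f^(k/2) P(U_n = t) tends to the Gaussian density at 0. *)

theory Submission
  imports Defs
begin

text \<open>Convergence in distribution only sees fixed regions on the scale
  \<open>sqrt (f n)\<close>, whereas a single lattice point near the mean has mass of order
  \<open>f n powr (- k / 2)\<close>. The order of choices bridges the two scales: the half-side
  \<open>r\<close> of the cube depends on the accuracy alone, through continuity of the density and
  \<open>locally_regular\<close>, and only then does \<open>n\<close> grow. Continuous test
  functions bound the masses of closed sets from above and of open sets from below, hence two
  versions of the cube. Growth of \<open>f\<close> and remoteness of the mean from the boundary are
  consequences of the limit law. It charges every nonempty open set, while the counts are integers,
  so the rescaled lattice must become arbitrarily fine, and nonnegative, so each coordinate of the
  mean must exceed any multiple of \<open>sqrt (f n)\<close>. Positivity of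
  \<open>det V\<^sub>0\<close> is derived too: \<open>V\<^sub>0\<close> is invertible and a limit of
  positive semidefinite matrices. Homogeneity of the determinant finally turns
  \<open>det V\<^sub>0\<close> into the determinant of the actual covariance matrix.\<close>

section \<open>Expected number of draws until acceptance\<close>

text \<open>The count is a sum of indicators over the positions \<open>j\<close>, so its expectation
  is a geometric series: position \<open>j\<close> contributes
  \<open>P(B) * (1 - P(A)) ^ j\<close>.\<close>

lemma nn_integral_draws_until:
  fixes p :: "'b pmf"
  assumes AB: "A \<subseteq> B" and pos: "0 < measure_pmf.prob p A"
  shows "(\<integral>\<^sup>+ \<omega>. (if \<exists>j. \<omega> j \<in> A
            then of_nat (card {j. j \<le> (LEAST j. \<omega> j \<in> A) \<and> \<omega> j \<in> B}) else \<infinity>)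
            \<partial>(\<Pi>\<^sub>M j\<in>(UNIV :: nat set). measure_pmf p)) =
         ennreal (measure_pmf.prob p B / measure_pmf.prob p A)"
proof -
  interpret product_prob_space "\<lambda>_::nat. measure_pmf p" UNIV
    by standard
  let ?M = "\<Pi>\<^sub>M j\<in>(UNIV :: nat set). measure_pmf p"
  let ?r = "1 - measure_pmf.prob p A"
  have space: "space ?M = UNIV"
    by (auto simp: space_PiM)
  have r: "measure_pmf.prob p (- A) = ?r"
    using measure_pmf.prob_compl[of A p] by (simp add: Compl_eq_Diff_UNIV)
  have r_bounds: "0 \<le> ?r" "?r < 1"
    using pos measure_pmf.prob_le_1[of p A] by auto
  have meas: "{\<omega>. \<forall>i\<in>J. \<omega> i \<in> X i} \<in> sets ?M" if "finite J" for J and X :: "nat \<Rightarrow> 'b set"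
  proof -
    have "{\<omega>. \<forall>i\<in>J. \<omega> i \<in> X i} = prod_emb UNIV (\<lambda>_. measure_pmf p) J (Pi\<^sub>E J X)"
      by (auto simp: prod_emb_def)
    then show ?thesis using sets_PiM_I[OF that, of UNIV X "\<lambda>_. measure_pmf p"] by simp
  qed
  have em: "emeasure ?M {\<omega>. \<forall>i\<in>J. \<omega> i \<in> X i} = (\<Prod>i\<in>J. emeasure p (X i))"
    if "finite J" for J and X :: "nat \<Rightarrow> 'b set"
    using emeasure_PiM_Collect[OF _ that, of X] by (simp add: space)
  \<comment> \<open>Position \<open>j\<close> counts iff no earlier draw lies in \<open>A\<close>
    and draw \<open>j\<close> lies in \<open>B\<close>. The strict bound \<open>i < j\<close> lets
    the stopping draw itself count.\<close>
  define E where "E j = {\<omega>. (\<forall>i<j. \<omega> i \<notin> A) \<and> \<omega> j \<in> B}" for j :: nat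
  have E_alt: "E j = {\<omega>. \<forall>i\<in>{..j}. \<omega> i \<in> (if i = j then B else - A)}" for j
    unfolding E_def by (auto simp: le_less)
  have E_sets: "E j \<in> sets ?M" for j
    unfolding E_alt by (rule meas) simp
  have E_em: "emeasure ?M (E j) = ennreal (measure_pmf.prob p B * ?r ^ j)" for j
  proof -
    have "emeasure ?M (E j) = (\<Prod>i\<in>{..j}. emeasure p (if i = j then B else - A))"
      unfolding E_alt by (rule em) simp
    also have "\<dots> = emeasure p B * (\<Prod>i<j. emeasure p (- A))"
      by (simp add: lessThan_Suc_atMost[symmetric] mult.commute)
    also have "\<dots> = ennreal (measure_pmf.prob p B * ?r ^ j)"
      using r_bounds by (simp add: measure_pmf.emeasure_eq_measure r ennreal_mult ennreal_power)
    finally show ?thesis .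
  qed
  \<comment> \<open>The runs that never stop, where the count is infinite, form a null set: they lie
    in each of the cylinders of probability \<open>(1 - P(A)) ^ j\<close>.\<close>
  define N where "N = {\<omega> :: nat \<Rightarrow> 'b. \<forall>j. \<omega> j \<notin> A}"
  have N_sets: "N \<in> sets ?M"
  proof -
    have "N = (\<Inter>j. {\<omega>. \<forall>i\<in>{j}. \<omega> i \<in> - A})" by (auto simp: N_def)
    also have "\<dots> \<in> sets ?M" 

    proof (rule sets.countable_INT'')
      show "UNIV \<in> sets ?M" using sets.top[of ?M] by (simp only: space)
      show "{\<omega>. \<forall>i\<in>{j}. \<omega> i \<in> - A} \<in> sets ?M" for j
        by (rule meas) simp
    qed simp
    finally show ?thesis .
  qed
  have "emeasure ?M N \<le> ennreal (?r ^ j)" for j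
  proof -
    have "emeasure ?M N \<le> emeasure ?M {\<omega>. \<forall>i\<in>{..<j}. \<omega> i \<in> - A}"
      by (intro emeasure_mono meas) (auto simp: N_def)
    also have "\<dots> = ennreal (?r ^ j)"
      using r_bounds em[of "{..<j}" "\<lambda>_. - A"] by (simp add: measure_pmf.emeasure_eq_measure r ennreal_power)
    finally show ?thesis .
  qed
  moreover have "(\<lambda>j. ennreal (?r ^ j)) \<longlonglongrightarrow> ennreal 0"
    using r_bounds by (intro tendsto_ennrealI LIMSEQ_realpow_zero) auto
  ultimately have "emeasure ?M N \<le> ennreal 0"
    by (intro LIMSEQ_le_const) auto
  then have "N \<in> null_sets ?M" using N_sets by (auto intro!: null_setsI)
  then have AE: "AE \<omega> in ?M. \<exists>j. \<omega> j \<in> A"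
    by (rule AE_I') (auto simp: N_def)
  have pt: "(of_nat (card {j. j \<le> (LEAST j. \<omega> j \<in> A) \<and> \<omega> j \<in> B}) :: ennreal)
      = (\<Sum>j. indicator (E j) \<omega>)" if "\<exists>j. \<omega> j \<in> A" for \<omega> :: "nat \<Rightarrow> 'b"
  proof -
    let ?T = "LEAST j. \<omega> j \<in> A"
    have T: "\<omega> ?T \<in> A" using that by (rule LeastI_ex)
    have "(\<forall>i<j. \<omega> i \<notin> A) \<longleftrightarrow> j \<le> ?T" for j
      using T not_less_Least[of _ "\<lambda>j. \<omega> j \<in> A"] by (meson less_le_trans not_le)
    then have iff: "\<omega> \<in> E j \<longleftrightarrow> j \<le> ?T \<and> \<omega> j \<in> B" for j
      by (simp add: E_def)
    have "(\<Sum>j. indicator (E j) \<omega> :: ennreal) = (\<Sum>j\<in>{..?T}. indicator (E j) \<omega>)"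
      by (rule suminf_finite) (auto simp: iff)
    also have "\<dots> = (\<Sum>j\<in>{j. j \<le> ?T \<and> \<omega> j \<in> B}. 1)"
      by (rule sum.mono_neutral_cong_right) (auto simp: iff)
    finally show ?thesis by simp
  qed
  have "(\<integral>\<^sup>+ \<omega>. (if \<exists>j. \<omega> j \<in> A
            then of_nat (card {j. j \<le> (LEAST j. \<omega> j \<in> A) \<and> \<omega> j \<in> B}) else \<infinity>) \<partial>?M)
        = (\<integral>\<^sup>+ \<omega>. (\<Sum>j. indicator (E j) \<omega>) \<partial>?M)"
    by (rule nn_integral_cong_AE) (use AE in \<open>eventually_elim, simp add: pt\<close>)
  also have "\<dots> = (\<Sum>j. emeasure ?M (E j))"
    using E_sets by (simp add: nn_integral_suminf)
  also have "\<dots> = ennreal (measure_pmf.prob p B * (1 / (1 - ?r)))"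
    unfolding E_em using r_bounds
    by (intro suminf_ennreal_eq sums_mult geometric_sums) auto
  finally show ?thesis by simp
qed

section \<open>Convergence in distribution and masses of closed and open sets\<close>

text \<open>Continuous functions above the indicator of \<open>C\<close> and converging to it
  pointwise transfer the limit: one of them already has integral below
  \<open>measure N C + e\<close>, and it dominates the indicator under every
  \<open>p n\<close>.\<close>

lemma portmanteau_closed:
  fixes p :: "'i \<Rightarrow> 'b pmf" and X :: "'i \<Rightarrow> 'b \<Rightarrow> 'a::metric_space" and N :: "'a measure"
  assumes N: "prob_space N" "sets N = sets borel"
    and lim: "\<And>g :: 'a \<Rightarrow> real. continuous_on UNIV g \<Longrightarrow> bounded (range g) \<Longrightarrow>
        ((\<lambda>n. measure_pmf.expectation (p n) (\<lambda>m. g (X n m))) \<longlongrightarrow> (LINT y|N. g y)) F"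
    and C: "closed C" and e: "0 < e"
  shows "\<forall>\<^sub>F n in F. measure_pmf.prob (p n) {m. X n m \<in> C} < measure N C + e"
proof (cases "C = {}")
  \<comment> \<open>\<open>infdist\<close> to the empty set is 0 by convention, so the cutoffs below
    would be constantly 1.\<close>
  case True
  then show ?thesis using e by simp
next
  case False
  interpret N: prob_space N by fact
  \<comment> \<open>A cutoff that is 1 on \<open>C\<close> and falls to 0 at distance
    \<open>1 / j\<close>. Since \<open>C\<close> is closed, points outside have positive distance
    and are eventually cut off.\<close>
  define g where "g j y = max 0 (1 - real j * infdist y C)" for j y
  have g_cont: "continuous_on UNIV (g j)" for j
    unfolding g_def by (intro continuous_intros continuous_on_infdist)
  have g_bd: "0 \<le> g j y" "g j y \<le> 1" for j y
    using infdist_nonneg[of y C] by (auto simp: g_def)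
  have g_lim: "(\<lambda>j. g j y) \<longlonglongrightarrow> indicator C y" for y
  proof (cases "y \<in> C")
    case True
    then show ?thesis by (simp add: g_def)
  next
    case False
    then have d: "0 < infdist y C"
      using C \<open>C \<noteq> {}\<close> infdist_pos_not_in_closed by blast
    have "\<forall>\<^sub>F j in sequentially. g j y = 0"
    proof -
      obtain J :: nat where J: "1 / infdist y C < real J" using reals_Archimedean2 by blast
      show ?thesis
      proof (rule eventually_sequentiallyI[of J])
        fix j assume "J \<le> j"
        then have "1 / infdist y C < real j" using J by linarith
        then show "g j y = 0" using d by (simp add: g_def field_simps)
      qed
    qed
    then show ?thesis using False by (simp add: tendsto_eventually)
  qed
  have borel: "g j \<in> borel_measurable N" for j
    using borel_measurable_continuous_onI[OF g_cont] measurable_cong_sets[OF N(2) refl] by blast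
  have C_sets: "C \<in> sets N" using C N(2) by simp
  have "(\<lambda>j. LINT y|N. g j y) \<longlonglongrightarrow> (LINT y|N. indicator C y)"
    by (rule integral_dominated_convergence[where w = "\<lambda>_. 1"])
       (use C_sets borel g_lim g_bd in \<open>auto\<close>)
  also have "(LINT y|N. indicator C y) = measure N C"
    using C_sets by simp
  finally have "\<forall>\<^sub>F j in sequentially. (LINT y|N. g j y) < measure N C + e"
    using e by (intro order_tendstoD) auto
  then obtain j where j: "(LINT y|N. g j y) < measure N C + e"
    by (auto simp: eventually_sequentially)
  have "bounded (range (g j))"
    using g_bd by (intro boundedI[of _ 1]) auto
  then have "\<forall>\<^sub>F n in F. measure_pmf.expectation (p n) (\<lambda>m. g j (X n m)) < measure N C + e"
    using lim[OF g_cont] j by (intro order_tendstoD(2))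
  then show ?thesis
  proof eventually_elim
    case (elim n)
    have "measure_pmf.prob (p n) {m. X n m \<in> C}
        = measure_pmf.expectation (p n) (indicator {m. X n m \<in> C})"
      by simp
    also have "\<dots> \<le> measure_pmf.expectation (p n) (\<lambda>m. g j (X n m))"
    proof (rule integral_mono)
      show "integrable (measure_pmf (p n)) (\<lambda>m. g j (X n m))"
        using g_bd by (intro measure_pmf.integrable_const_bound[where B = 1]) auto
      show "integrable (measure_pmf (p n)) (indicat_real {m. X n m \<in> C})" 
        by (intro measure_pmf.integrable_const_bound[where B = 1]) auto
      show "indicator {m. X n m \<in> C} m \<le> g j (X n m)" for m
        using g_bd(1)[of j "X n m"] by (auto simp: indicator_def g_def)
    qed
    finally show ?case using elim by linarith
  qed
qed

lemma portmanteau_open: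
  fixes p :: "'i \<Rightarrow> 'b pmf" and X :: "'i \<Rightarrow> 'b \<Rightarrow> 'a::metric_space" and N :: "'a measure"
  assumes N: "prob_space N" "sets N = sets borel"
    and lim: "\<And>g :: 'a \<Rightarrow> real. continuous_on UNIV g \<Longrightarrow> bounded (range g) \<Longrightarrow>
        ((\<lambda>n. measure_pmf.expectation (p n) (\<lambda>m. g (X n m))) \<longlongrightarrow> (LINT y|N. g y)) F"
    and S: "open S" and e: "0 < e"
  shows "\<forall>\<^sub>F n in F. measure N S - e < measure_pmf.prob (p n) {m. X n m \<in> S}"
proof -
  have "\<forall>\<^sub>F n in F. measure_pmf.prob (p n) {m. X n m \<in> - S} < measure N (- S) + e"
  proof (rule portmanteau_closed[OF N _ closed_Compl[OF S] e])
    fix g :: "'a \<Rightarrow> real" assume "continuous_on UNIV g" "bounded (range g)"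
    then show "((\<lambda>n. measure_pmf.expectation (p n) (\<lambda>m. g (X n m))) \<longlongrightarrow> (LINT y|N. g y)) F"
      by (rule lim[of g])
  qed
  then show ?thesis
  proof eventually_elim
    case (elim n)
    interpret N: prob_space N by fact
    have "space N = UNIV" using sets_eq_imp_space_eq[OF N(2)] by simp
    then have "measure N (- S) = 1 - measure N S"
      using N.prob_compl[of S] S N(2) by (simp add: Compl_eq_Diff_UNIV)
    moreover have "measure_pmf.prob (p n) {m. X n m \<in> - S}
        = 1 - measure_pmf.prob (p n) {m. X n m \<in> S}"
      using measure_pmf.prob_compl[of "{m. X n m \<in> S}" "p n"]
      by (simp add: set_diff_eq)
    ultimately show ?case using elim by linarith
  qed
qed

section \<open>The Gaussian law\<close>

text \<open>For \<open>sqrt (det V) = 0\<close> division by zero yields the constant 0, which is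
  continuous as well.\<close>

lemma gaussian_density_cont:
  fixes V :: "real ^ 'k::finite ^ 'k"
  shows "continuous_on UNIV (\<lambda>y. exp (- (y \<bullet> (matrix_inv V *v y)) / 2) /
                     ((2 * pi) powr (real CARD('k) / 2) * sqrt (det V)))"
  by (cases "sqrt (det V) = 0")
    (auto intro!: continuous_intros linear_continuous_on[OF matrix_vector_mul_bounded_linear])

text \<open>Testing the limit on the constant function 1 gives total mass 1 without evaluating a
  Gaussian integral. An infinite total mass is excluded because \<open>measure\<close> would then be
  0.\<close>

lemma prob_space_gaussian:
  assumes "gaussian_limit F U f V" "F \<noteq> bot"
  shows "prob_space (gaussian V)"
proof -
  let ?N = "gaussian V"
  have "((\<lambda>n. measure_pmf.expectation (U n) (\<lambda>_. 1 :: real)) \<longlongrightarrow> (LINT y|?N. 1)) F"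
    using assms(1) unfolding gaussian_limit_def by (elim allE[where x = "\<lambda>_. 1"]) auto
  then have "(LINT y|?N. 1 :: real) = 1"
    using tendsto_unique[OF assms(2) _ tendsto_const] by force
  then have "measure ?N (space ?N) = 1" by simp
  then have "emeasure ?N (space ?N) = 1"
    by (cases "emeasure ?N (space ?N)") (auto simp: measure_def simp flip: ennreal_1)
  then show ?thesis by (rule prob_spaceI)
qed

lemma sets_gaussian [simp]: "sets (gaussian V) = sets borel"
  by (simp add: gaussian_def)

lemma gaussian_open_pos:
  fixes V :: "real ^ 'k::finite ^ 'k"
  assumes P: "prob_space (gaussian V)" and det: "0 < det V" and S: "open S" "S \<noteq> {}"
  shows "0 < measure (gaussian V) S"
proof -
  interpret prob_space "gaussian V" by fact
  let ?h = "\<lambda>y. exp (- (y \<bullet> (matrix_inv V *v y)) / 2) /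
                     ((2 * pi) powr (real CARD('k) / 2) * sqrt (det V))"
  have pos: "0 < ?h y" for y using det by simp
  have h: "(\<lambda>y. ennreal (?h y)) \<in> borel_measurable lborel"
    using borel_measurable_continuous_onI[OF gaussian_density_cont[of V]] by simp
  have "S \<notin> null_sets (gaussian V)"
  proof
    assume "S \<in> null_sets (gaussian V)"
    then have "AE y in lborel. y \<in> S \<longrightarrow> ennreal (?h y) = 0"
      unfolding gaussian_def null_sets_density_iff[OF h] by simp
    then have "AE y in lborel. y \<notin> S"
    proof eventually_elim
      case (elim y)
      then show ?case using ennreal_eq_0_iff[of "?h y"] not_le[of "?h y" 0] pos[of y] by blast
    qed
    then have "S \<in> null_sets lborel"
      using S by (simp add: AE_iff_null_sets)
    then have "negligible S"
      by (simp add: negligible_iff_null_sets null_sets_completionI)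
    then show False using open_not_negligible S by blast
  qed
  then have "measure (gaussian V) S \<noteq> 0"
    using S by (auto simp: emeasure_eq_measure null_sets_def)
  then show ?thesis by (simp add: zero_less_measure_iff)
qed

text \<open>Near 0 the density stays within \<open>e\<close> of \<open>h 0\<close>, so the mass of a
  cube is its volume times nearly \<open>h 0\<close>. The bound \<open>e \<le> h 0\<close> keeps the
  lower constant nonnegative, where \<open>ennreal\<close> respects products.\<close>

lemma cube_mass:
  fixes h :: "real ^ 'k::finite \<Rightarrow> real"
  assumes P: "prob_space (density lborel (\<lambda>y. ennreal (h y)))"
    and h: "continuous_on UNIV h" and e: "0 < e" "e \<le> h 0"
  shows "\<exists>\<delta>>0. \<forall>r. 0 < r \<and> r \<le> \<delta> \<longrightarrow>
     measure (density lborel (\<lambda>y. ennreal (h y))) {y. \<forall>i. \<bar>y $ i\<bar> \<le> r} \<le> (h 0 + e) * (2 * r) ^ CARD('k) \<and>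
     (h 0 - e) * (2 * r) ^ CARD('k) \<le> measure (density lborel (\<lambda>y. ennreal (h y))) {y. \<forall>i. \<bar>y $ i\<bar> < r}"
proof -
  let ?N = "density lborel (\<lambda>y. ennreal (h y))"
  interpret prob_space ?N by fact
  have hm: "(\<lambda>y. ennreal (h y)) \<in> borel_measurable lborel"
    using borel_measurable_continuous_onI[OF h] by simp
  from h e(1) obtain d where d: "0 < d" "\<And>y. dist y 0 < d \<Longrightarrow> dist (h y) (h 0) < e"
    unfolding continuous_on_iff by blast
  \<comment> \<open>The Euclidean norm is at most the sum of the coordinates' absolute values, here
    at most \<open>d / 2\<close>, which is strictly below \<open>d\<close>.\<close>
  define \<delta> where "\<delta> = d / (2 * real CARD('k))"
  have \<delta>: "0 < \<delta>" using d by (simp add: \<delta>_def)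
  have near: "h 0 - e \<le> h y \<and> h y \<le> h 0 + e" if "\<forall>i. \<bar>y $ i\<bar> \<le> r" "r \<le> \<delta>" for y r
  proof -
    have "norm y \<le> (\<Sum>i\<in>UNIV. \<bar>y $ i\<bar>)" by (rule norm_le_l1_cart)
    also have "\<dots> \<le> (\<Sum>i\<in>(UNIV::'k set). \<delta>)" by (intro sum_mono) (use that in \<open>force intro: order_trans\<close>)
    also have "\<dots> = d / 2" by (simp add: \<delta>_def)
    finally have "dist y 0 < d" using d by simp
    from d(2)[OF this] show ?thesis by (auto simp: dist_real_def)
  qed
  show ?thesis
  proof (intro exI[of _ \<delta>] conjI allI impI \<delta>; elim conjE)
    fix r assume r: "0 < r" "r \<le> \<delta>"
    let ?a = "(\<chi> i. - r) :: real ^ 'k" and ?b = "(\<chi> i. r) :: real ^ 'k"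
    have C: "{y :: real ^ 'k. \<forall>i. \<bar>y $ i\<bar> \<le> r} = cbox ?a ?b"
      by (auto simp: mem_box_cart abs_le_iff minus_le_iff)
    have O: "{y :: real ^ 'k. \<forall>i. \<bar>y $ i\<bar> < r} = box ?a ?b"
      by (auto simp: mem_box_cart abs_less_iff minus_less_iff)
    have ne: "cbox ?a ?b \<noteq> {}" using r by (auto simp: interval_ne_empty_cart)
    have vol: "measure lborel (cbox ?a ?b) = (2 * r) ^ CARD('k)"
      using content_cbox_cart[OF ne] by simp
    have volO: "measure lborel (box ?a ?b) = (2 * r) ^ CARD('k)"
      using vol by (simp add: measure_lborel_box_eq measure_lborel_cbox_eq)
    have emC: "emeasure lborel (cbox ?a ?b) = ennreal ((2 * r) ^ CARD('k))"
      using emeasure_eq_ennreal_measure[of lborel "cbox ?a ?b"] emeasure_lborel_cbox_finite[of ?a ?b]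
      unfolding vol by (simp add: less_top)
    have emO: "emeasure lborel (box ?a ?b) = ennreal ((2 * r) ^ CARD('k))"
      using emeasure_eq_ennreal_measure[of lborel "box ?a ?b"] emeasure_lborel_box_finite[of ?a ?b]
      unfolding volO by (simp add: less_top)
    have "emeasure ?N (cbox ?a ?b) = (\<integral>\<^sup>+ y. ennreal (h y) * indicator (cbox ?a ?b) y \<partial>lborel)"
      by (rule emeasure_density[OF hm]) simp
    also have "\<dots> \<le> (\<integral>\<^sup>+ y. ennreal (h 0 + e) * indicator (cbox ?a ?b) y \<partial>lborel)"
      using near[OF _ r(2)] unfolding C[symmetric]
      by (intro nn_integral_mono) (auto simp: indicator_def intro!: ennreal_leI)
    also have "\<dots> = ennreal (h 0 + e) * ennreal ((2 * r) ^ CARD('k))"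
      by (subst nn_integral_cmult_indicator) (auto simp: emC)
    also have "\<dots> = ennreal ((h 0 + e) * (2 * r) ^ CARD('k))"
      using e r by (simp add: ennreal_mult)
    finally show "measure ?N {y. \<forall>i. \<bar>y $ i\<bar> \<le> r} \<le> (h 0 + e) * (2 * r) ^ CARD('k)"
      using e r unfolding C by (simp add: emeasure_eq_measure)
    have "ennreal ((h 0 - e) * (2 * r) ^ CARD('k)) = ennreal (h 0 - e) * ennreal ((2 * r) ^ CARD('k))"
      using e r by (simp add: ennreal_mult)
    also have "\<dots> = (\<integral>\<^sup>+ y. ennreal (h 0 - e) * indicator (box ?a ?b) y \<partial>lborel)"
      by (subst nn_integral_cmult_indicator) (auto simp: emO)
    also have "\<dots> \<le> (\<integral>\<^sup>+ y. ennreal (h y) * indicator (box ?a ?b) y \<partial>lborel)"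
      using near[OF _ r(2)] unfolding O[symmetric]
      by (intro nn_integral_mono) (auto simp: indicator_def less_imp_le intro!: ennreal_leI)
    also have "\<dots> = emeasure ?N (box ?a ?b)"
      by (rule emeasure_density[OF hm, symmetric]) simp
    finally show "(h 0 - e) * (2 * r) ^ CARD('k) \<le> measure ?N {y. \<forall>i. \<bar>y $ i\<bar> < r}"
      unfolding O by (simp add: emeasure_eq_measure)
  qed
qed

section \<open>Lattice points in boxes\<close>

lemma card_vec_box:
  fixes T :: "'k::finite \<Rightarrow> 'b set"
  shows "card {m :: 'b ^ 'k. \<forall>i. m $ i \<in> T i} = (\<Prod>i\<in>UNIV. card (T i))"
proof -
  have "bij_betw vec_nth {m :: 'b ^ 'k. \<forall>i. m $ i \<in> T i} (\<Pi>\<^sub>E i\<in>UNIV. T i)"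
    by (rule bij_betw_byWitness[where f' = vec_lambda]) auto
  then show ?thesis by (simp add: bij_betw_same_card card_PiE)
qed

lemma card_nat_interval:
  fixes c h :: real
  assumes "0 \<le> h" "h \<le> c"
  shows "2 * h - 1 \<le> real (card {j :: nat. \<bar>real j - c\<bar> \<le> h})"
    "real (card {j :: nat. \<bar>real j - c\<bar> \<le> h}) \<le> 2 * h + 1"
    "finite {j :: nat. \<bar>real j - c\<bar> \<le> h}"
proof -
  \<comment> \<open>Because \<open>h \<le> c\<close>, both endpoints are nonnegative and
    \<open>nat\<close> truncates nothing.\<close>
  let ?A = "nat \<lceil>c - h\<rceil>" and ?B = "nat \<lfloor>c + h\<rfloor>"
  have A: "real ?A = of_int \<lceil>c - h\<rceil>" and B: "real ?B = of_int \<lfloor>c + h\<rfloor>"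
    using assms by (auto intro!: of_nat_nat)
  have bd: "c - h \<le> real ?A" "real ?A < c - h + 1" "real ?B \<le> c + h" "c + h < real ?B + 1"
    unfolding A B by linarith+
  have eq: "{j :: nat. \<bar>real j - c\<bar> \<le> h} = {?A..?B}"
  proof (intro set_eqI iffI)
    fix j :: nat assume "j \<in> {j. \<bar>real j - c\<bar> \<le> h}"
    then have "c - h \<le> real j" "real j \<le> c + h" by (auto simp: abs_le_iff)
    then have "real ?A < real (Suc j)" "real j < real (Suc ?B)"
      unfolding of_nat_Suc using bd by linarith+
    then have "?A < Suc j" "j < Suc ?B" by (simp_all only: of_nat_less_iff)
    then show "j \<in> {?A..?B}" by (simp only: less_Suc_eq_le atLeastAtMost_iff)
  next
    fix j :: nat assume "j \<in> {?A..?B}"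
    then have "real ?A \<le> real j" "real j \<le> real ?B"
      by (simp_all only: atLeastAtMost_iff of_nat_le_iff)
    then have "c - h \<le> real j" "real j \<le> c + h" using bd by linarith+
    then show "j \<in> {j. \<bar>real j - c\<bar> \<le> h}" by (simp add: abs_le_iff)
  qed
  show "finite {j :: nat. \<bar>real j - c\<bar> \<le> h}" by (simp add: eq)
  \<comment> \<open>The interval may be empty with \<open>?A = ?B + 1\<close>; this bound makes the
    natural subtraction in \<open>Suc ?B - ?A\<close> exact in that case too.\<close>
  have "real ?A < real (Suc (Suc ?B))" unfolding of_nat_Suc using bd assms by linarith
  then have "?A \<le> Suc ?B" by (simp only: of_nat_less_iff less_Suc_eq_le)
  then have "real (card {j :: nat. \<bar>real j - c\<bar> \<le> h}) = 1 + real ?B - real ?A"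
    unfolding eq card_atLeastAtMost by (simp only: of_nat_diff of_nat_Suc)
  then show "2 * h - 1 \<le> real (card {j :: nat. \<bar>real j - c\<bar> \<le> h})"
    "real (card {j :: nat. \<bar>real j - c\<bar> \<le> h}) \<le> 2 * h + 1"
    using bd by linarith+
qed

section \<open>What a Gaussian limit forces on the scale and the mean\<close>

lemma gaussian_limit_closed:
  fixes V :: "real ^ 'b::finite ^ 'b"
  assumes lim: "gaussian_limit F U f V" and F: "F \<noteq> bot" and S: "closed S" and e: "0 < e"
  shows "\<forall>\<^sub>F n in F. measure_pmf.prob (U n)
      {m. (1 / sqrt (f n)) *\<^sub>R (rvec m - mean_vec (U n)) \<in> S} < measure (gaussian V) S + e"
proof (rule portmanteau_closed[where p = U and X = "\<lambda>n m. (1 / sqrt (f n)) *\<^sub>R (rvec m - mean_vec (U n))",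
      OF prob_space_gaussian[OF lim F] sets_gaussian _ S e])
  fix g :: "real ^ 'b \<Rightarrow> real"
  assume "continuous_on UNIV g" "bounded (range g)"
  then show "((\<lambda>n. measure_pmf.expectation (U n)
      (\<lambda>m. g ((1 / sqrt (f n)) *\<^sub>R (rvec m - mean_vec (U n))))) \<longlongrightarrow> (LINT y|gaussian V. g y)) F"
    using lim unfolding gaussian_limit_def by blast
qed

lemma gaussian_limit_open:
  fixes V :: "real ^ 'b::finite ^ 'b"
  assumes lim: "gaussian_limit F U f V" and F: "F \<noteq> bot" and S: "open S" and e: "0 < e"
  shows "\<forall>\<^sub>F n in F. measure (gaussian V) S - e < measure_pmf.prob (U n)
      {m. (1 / sqrt (f n)) *\<^sub>R (rvec m - mean_vec (U n)) \<in> S}"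
proof (rule portmanteau_open[where p = U and X = "\<lambda>n m. (1 / sqrt (f n)) *\<^sub>R (rvec m - mean_vec (U n))",
      OF prob_space_gaussian[OF lim F] sets_gaussian _ S e])
  fix g :: "real ^ 'b \<Rightarrow> real"
  assume "continuous_on UNIV g" "bounded (range g)"
  then show "((\<lambda>n. measure_pmf.expectation (U n)
      (\<lambda>m. g ((1 / sqrt (f n)) *\<^sub>R (rvec m - mean_vec (U n))))) \<longlongrightarrow> (LINT y|gaussian V. g y)) F"
    using lim unfolding gaussian_limit_def by blast
qed

text \<open>With the limit mass of \<open>S\<close> itself as error term, the lower bound for open
  sets reads \<open>0 < prob\<close>, so some count vector must be rescaled into
  \<open>S\<close>.\<close>

lemma gaussian_limit_hits_open:
  fixes S :: "(real ^ 'k::finite) set"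
  assumes lim: "gaussian_limit F U f V" and F: "F \<noteq> bot" and det: "0 < det V"
    and S: "open S" "S \<noteq> {}"
  shows "\<forall>\<^sub>F n in F. \<exists>m. (1 / sqrt (f n)) *\<^sub>R (rvec m - mean_vec (U n)) \<in> S"
  using gaussian_limit_open[OF lim F S(1)
      gaussian_open_pos[OF prob_space_gaussian[OF lim F] det S]]
proof eventually_elim
  case (elim n)
  show ?case
  proof (rule ccontr)
    assume "\<not> ?case"
    then have "{m. (1 / sqrt (f n)) *\<^sub>R (rvec m - mean_vec (U n)) \<in> S} = {}" by blast
    with elim show False by simp
  qed
qed

lemma one_le_norm_rvec_diff:
  assumes "m \<noteq> m'"
  shows "1 \<le> norm (rvec m - rvec m')"
proof -
  obtain i where i: "m $ i \<noteq> m' $ i" using assms by (auto simp: vec_eq_iff)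
  then have "1 \<le> \<bar>real (m $ i) - real (m' $ i)\<bar>" by linarith
  also have "\<dots> = \<bar>(rvec m - rvec m') $ i\<bar>" by (simp add: rvec_def)
  also have "\<dots> \<le> norm (rvec m - rvec m')" by (rule component_le_norm_cart)
  finally show ?thesis .
qed

text \<open>If \<open>f\<close> stayed bounded, a small ball would contain at most one point of the rescaled lattice,
  but two disjoint balls inside it would both have positive limit mass.\<close>

lemma gaussian_limit_scale_at_top:
  fixes V :: "real ^ 'k::finite ^ 'k"
  assumes lim: "gaussian_limit F U f V" and F: "F \<noteq> bot" and det: "0 < det V"
    and f: "\<forall>\<^sub>F n in F. 0 < f n"
  shows "filterlim f at_top F"
  unfolding filterlim_at_top
proof
  fix K :: real
  \<comment> \<open>Points of \<open>ball 0 r\<close> and \<open>ball c r\<close> with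
    \<open>norm c = 2 * r\<close> are distinct and less than \<open>4 * r\<close> apart, whereas
    distinct count vectors are at least 1 apart. Hence \<open>1 < 4 * r * sqrt (f n)\<close>, which
    for this \<open>r\<close> means \<open>max K 1 < f n\<close>; the maximum keeps \<open>r\<close>
    positive.\<close>
  define r where "r = 1 / (4 * sqrt (max K 1))"
  have r: "0 < r" by (simp add: r_def)
  define c :: "real ^ 'k" where "c = (2 * r) *\<^sub>R axis undefined 1"
  have c: "norm c = 2 * r" using r by (simp add: c_def norm_axis_1)
  have "\<forall>\<^sub>F n in F. \<exists>m. (1 / sqrt (f n)) *\<^sub>R (rvec m - mean_vec (U n)) \<in> ball 0 r"
    "\<forall>\<^sub>F n in F. \<exists>m. (1 / sqrt (f n)) *\<^sub>R (rvec m - mean_vec (U n)) \<in> ball c r"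
    using r by (intro gaussian_limit_hits_open[OF lim F det]; simp)+
  then show "\<forall>\<^sub>F n in F. K \<le> f n"
    using f
  proof eventually_elim
    case (elim n)
    let ?X = "\<lambda>m. (1 / sqrt (f n)) *\<^sub>R (rvec m - mean_vec (U n))"
    obtain m m' where m: "norm (?X m) < r" and m': "norm (?X m' - c) < r"
      using elim by (auto simp: dist_norm norm_minus_commute)
    have "norm c < r + r" if "norm y < r" "norm (y - c) < r" for y
      using norm_triangle_ineq4[of y "y - c"] that by simp
    then have ne: "m \<noteq> m'" using m m' c by fastforce
    have "norm (?X m - ?X m') = norm (?X m - (?X m' - c) - c)" by simp
    also have "\<dots> \<le> norm (?X m) + norm (?X m' - c) + norm c"
      by (meson add_right_mono norm_triangle_ineq4 order_trans)
    also have "\<dots> < 4 * r" using m m' c by linarith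
    finally have "norm (?X m - ?X m') < 4 * r" .
    moreover have "?X m - ?X m' = (1 / sqrt (f n)) *\<^sub>R (rvec m - rvec m')"
      by (simp flip: scaleR_diff_right)
    ultimately have "norm (rvec m - rvec m') / sqrt (f n) < 4 * r"
      using elim(3) by simp
    then have "norm (rvec m - rvec m') < 4 * r * sqrt (f n)"
      using elim(3) by (simp add: field_simps)
    then have "1 < 4 * r * sqrt (f n)"
      using one_le_norm_rvec_diff[OF ne] by linarith
    then have "sqrt (max K 1) < sqrt (f n)"
      by (simp add: r_def field_simps)
    then show ?case by simp
  qed
qed

text \<open>The counts are nonnegative, so mass of the limit far below zero in coordinate \<open>i\<close> forces the
  mean of that coordinate to be of larger order than \<open>f\<^sup>1\<^sup>/\<^sup>2\<close>.\<close>

lemma gaussian_limit_mean_ge: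
  fixes V :: "real ^ 'k::finite ^ 'k"
  assumes lim: "gaussian_limit F U f V" and F: "F \<noteq> bot" and det: "0 < det V"
    and f: "\<forall>\<^sub>F n in F. 0 < f n"
  shows "\<forall>\<^sub>F n in F. \<forall>i. r * sqrt (f n) \<le> mean_vec (U n) $ i"
proof (rule eventually_all_finite)
  fix i :: 'k
  let ?S = "{y :: real ^ 'k. y $ i < - r}"
  have "open ?S" by (intro open_Collect_less continuous_intros)
  moreover have "(\<chi> j. - r - 1) \<in> ?S" by simp
  ultimately have "\<forall>\<^sub>F n in F. \<exists>m. (1 / sqrt (f n)) *\<^sub>R (rvec m - mean_vec (U n)) \<in> ?S"
    by (intro gaussian_limit_hits_open[OF lim F det]) blast+
  with f show "\<forall>\<^sub>F n in F. r * sqrt (f n) \<le> mean_vec (U n) $ i"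
  proof eventually_elim
    case (elim n)
    then obtain m where "(1 / sqrt (f n)) * (real (m $ i) - mean_vec (U n) $ i) < - r"
      by (auto simp: rvec_def)
    then have "real (m $ i) - mean_vec (U n) $ i < - (r * sqrt (f n))"
      using elim(1) by (simp add: field_simps)
    then show ?case by linarith
  qed
qed

section \<open>The local limit theorem at the mean\<close>

lemma powr_half_eq_sqrt_power:
  assumes "0 < (x :: real)"
  shows "x powr (real k / 2) = sqrt x ^ k"
proof -
  have "x powr (real k / 2) = (x powr (1 / 2)) powr real k" by (simp add: powr_powr)
  then show ?thesis using assms by (simp add: powr_half_sqrt powr_realpow)
qed

text \<open>The bound \<open>1 \<le> 2 * h\<close> makes the factor \<open>2 * h - 1\<close>
  nonnegative, so that the coordinatewise estimates multiply; \<open>h \<le> c $ i\<close> keeps the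
  cube inside the orthant.\<close>

lemma card_count_cube:
  fixes c :: "real ^ 'k::finite"
  assumes h: "1 \<le> 2 * h" "\<And>i. h \<le> c $ i"
  defines "Q \<equiv> {m :: nat ^ 'k. \<forall>i. \<bar>real (m $ i) - c $ i\<bar> \<le> h}"
  shows "(2 * h - 1) ^ CARD('k) \<le> real (card Q)" "real (card Q) \<le> (2 * h + 1) ^ CARD('k)"
    "finite Q"
proof -
  have h0: "0 \<le> h" using h by simp
  have eq: "real (card Q) = (\<Prod>i\<in>UNIV. real (card {j :: nat. \<bar>real j - c $ i\<bar> \<le> h}))"
    using card_vec_box[of "\<lambda>i. {j :: nat. \<bar>real j - c $ i\<bar> \<le> h}"] by (simp add: Q_def)
  have "(\<Prod>i\<in>(UNIV :: 'k set). 2 * h - 1) \<le> real (card Q)"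
    unfolding eq using card_nat_interval(1)[OF h0 h(2)] h by (intro prod_mono) auto
  then show "(2 * h - 1) ^ CARD('k) \<le> real (card Q)" by simp
  have "real (card Q) \<le> (\<Prod>i\<in>(UNIV :: 'k set). 2 * h + 1)"
    unfolding eq using card_nat_interval(2)[OF h0 h(2)] h by (intro prod_mono) auto
  then show "real (card Q) \<le> (2 * h + 1) ^ CARD('k)" by simp
  have "bij_betw vec_nth Q (\<Pi>\<^sub>E i\<in>UNIV. {j :: nat. \<bar>real j - c $ i\<bar> \<le> h})"
    by (rule bij_betw_byWitness[where f' = vec_lambda]) (auto simp: Q_def)
  then show "finite Q"
    using card_nat_interval(3)[OF h0 h(2)] by (simp add: bij_betw_finite finite_PiE)
qed

lemma local_limit:
  fixes V :: "real ^ 'k::finite ^ 'k" and t :: "nat \<Rightarrow> nat ^ 'k"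
  assumes lim: "gaussian_limit F U f V" and reg: "locally_regular F U f"
    and F: "F \<noteq> bot" and det: "0 < det V" and f: "\<forall>\<^sub>F n in F. 0 < f n"
    and t: "\<forall>\<^sub>F n in F. \<forall>i. \<bar>real (t n $ i) - mean_vec (U n) $ i\<bar> < 1"
  shows "((\<lambda>n. f n powr (real CARD('k) / 2) * pmf (U n) (t n)) \<longlongrightarrow>
          1 / ((2 * pi) powr (real CARD('k) / 2) * sqrt (det V))) F"
proof (rule tendstoI)
  let ?k = "CARD('k)"
  let ?h = "\<lambda>y. exp (- (y \<bullet> (matrix_inv V *v y)) / 2) /
                     ((2 * pi) powr (real ?k / 2) * sqrt (det V))"
  define \<phi> where "\<phi> = 1 / ((2 * pi) powr (real ?k / 2) * sqrt (det V))"
  have \<phi>: "0 < \<phi>" "?h 0 = \<phi>" using det by (auto simp: \<phi>_def)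
  fix e :: real assume "0 < e"
  \<comment> \<open>Four errors of size \<epsilon> add up below: variation of the density,
    convergence of the cube's mass, the lattice point count, and irregularity of the point masses.
    The bound by \<phi> is what \<open>cube_mass\<close> asks for.\<close>
  define \<epsilon> where "\<epsilon> = min (e / 4) \<phi>"
  have \<epsilon>: "0 < \<epsilon>" "4 * \<epsilon> \<le> e" "\<epsilon> \<le> \<phi>" using \<open>0 < e\<close> \<phi> by (auto simp: \<epsilon>_def)
  obtain \<delta>1 where \<delta>1: "0 < \<delta>1" and reg': "\<forall>\<^sub>F n in F. \<forall>m m'.
        norm (rvec m - mean_vec (U n)) \<le> \<delta>1 * sqrt (f n) \<and>
        norm (rvec m' - mean_vec (U n)) \<le> \<delta>1 * sqrt (f n) \<longrightarrow>
        f n powr (real ?k / 2) * \<bar>pmf (U n) m - pmf (U n) m'\<bar> \<le> \<epsilon>"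
    using reg \<epsilon>(1) unfolding locally_regular_def by blast
  have gauss: "density lborel (\<lambda>y. ennreal (?h y)) = gaussian V" by (simp only: gaussian_def)
  have mass_ex: "\<exists>\<delta>>0. \<forall>r. 0 < r \<and> r \<le> \<delta> \<longrightarrow>
     measure (gaussian V) {y. \<forall>i. \<bar>y $ i\<bar> \<le> r} \<le> (\<phi> + \<epsilon>) * (2 * r) ^ ?k \<and>
     (\<phi> - \<epsilon>) * (2 * r) ^ ?k \<le> measure (gaussian V) {y. \<forall>i. \<bar>y $ i\<bar> < r}"
  proof -
    have P: "prob_space (density lborel (\<lambda>y. ennreal (?h y)))"
      unfolding gauss by (rule prob_space_gaussian[OF lim F])
    have "\<epsilon> \<le> ?h 0" using \<epsilon>(3) unfolding \<phi>(2) .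
    from cube_mass[OF P gaussian_density_cont[of V] \<epsilon>(1) this] show ?thesis
      unfolding gauss \<phi>(2) .
  qed
  then obtain \<delta>2 where \<delta>2: "0 < \<delta>2" and mass: "\<And>r. 0 < r \<Longrightarrow> r \<le> \<delta>2 \<Longrightarrow>
     measure (gaussian V) {y. \<forall>i. \<bar>y $ i\<bar> \<le> r} \<le> (\<phi> + \<epsilon>) * (2 * r) ^ ?k \<and>
     (\<phi> - \<epsilon>) * (2 * r) ^ ?k \<le> measure (gaussian V) {y. \<forall>i. \<bar>y $ i\<bar> < r}"
    by blast
  \<comment> \<open>\<open>\<delta>2\<close> serves the mass estimate. Division by \<open>k\<close>
    is the price of passing from the cube to the Euclidean ball of
    \<open>locally_regular\<close>.\<close>
  define r where "r = min \<delta>2 (\<delta>1 / real ?k)"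
  have r: "0 < r" "r \<le> \<delta>2" "real ?k * r \<le> \<delta>1"
    using \<delta>1 \<delta>2 by (auto simp: r_def min_def field_simps)
  define v where "v = (2 * r) ^ ?k"
  have v: "0 < v" using r by (simp add: v_def)
  let ?Q = "\<lambda>n. {m :: nat ^ 'k. \<forall>i. \<bar>real (m $ i) - mean_vec (U n) $ i\<bar> \<le> r * sqrt (f n)}"
  let ?w = "\<lambda>n. real (card (?Q n)) / sqrt (f n) ^ ?k"
  let ?X = "\<lambda>n m. (1 / sqrt (f n)) *\<^sub>R (rvec m - mean_vec (U n))"
  have sf: "filterlim (\<lambda>n. sqrt (f n)) at_top F"
    using filterlim_compose[OF sqrt_at_top gaussian_limit_scale_at_top[OF lim F det f]] .
  \<comment> \<open>This makes the lower lattice count nonnegative and also puts \<open>t n\<close>,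
    which is within 1 of the mean in each coordinate, into the cube.\<close>
  have big: "\<forall>\<^sub>F n in F. 1 \<le> r * sqrt (f n)"
  proof -
    have "\<forall>\<^sub>F n in F. 1 / r \<le> sqrt (f n)" using sf unfolding filterlim_at_top by blast
    then show ?thesis by eventually_elim (use r in \<open>simp add: field_simps\<close>)
  qed
  note mean = gaussian_limit_mean_ge[OF lim F det f, of r]
  have inv: "((\<lambda>n. 1 / sqrt (f n)) \<longlongrightarrow> 0) F"
    using tendsto_divide_0[OF tendsto_const filterlim_at_top_imp_at_infinity[OF sf]] .
  \<comment> \<open>In units of \<open>sqrt (f n)\<close> the counting error of one point per side
    is \<open>1 / sqrt (f n)\<close>, so the normalised count tends to the volume \<open>v\<close>
    of the rescaled cube.\<close>
  have w: "(?w \<longlongrightarrow> v) F"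
  proof (rule tendsto_sandwich)
    show "((\<lambda>n. (2 * r - 1 / sqrt (f n)) ^ ?k) \<longlongrightarrow> v) F"
      using tendsto_power[OF tendsto_diff[OF tendsto_const inv], of "2 * r" ?k] by (simp add: v_def)
    show "((\<lambda>n. (2 * r + 1 / sqrt (f n)) ^ ?k) \<longlongrightarrow> v) F"
      using tendsto_power[OF tendsto_add[OF tendsto_const inv], of "2 * r" ?k] by (simp add: v_def)
    show "\<forall>\<^sub>F n in F. (2 * r - 1 / sqrt (f n)) ^ ?k \<le> ?w n"
      using big mean f
    proof eventually_elim
      case (elim n)
      have "2 * r - 1 / sqrt (f n) = (2 * (r * sqrt (f n)) - 1) / sqrt (f n)"
        using elim(3) by (simp add: diff_divide_distrib)
      then have "(2 * r - 1 / sqrt (f n)) ^ ?k = (2 * (r * sqrt (f n)) - 1) ^ ?k / sqrt (f n) ^ ?k"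
        by (simp only: power_divide)
      also have "\<dots> \<le> ?w n"
        using elim by (intro divide_right_mono card_count_cube) auto
      finally show ?case .
    qed
    show "\<forall>\<^sub>F n in F. ?w n \<le> (2 * r + 1 / sqrt (f n)) ^ ?k"
      using big mean f
    proof eventually_elim
      case (elim n)
      have eq: "2 * r + 1 / sqrt (f n) = (2 * (r * sqrt (f n)) + 1) / sqrt (f n)"
        using elim(3) by (simp add: add_divide_distrib)
      have "?w n \<le> (2 * (r * sqrt (f n)) + 1) ^ ?k / sqrt (f n) ^ ?k"
        using elim by (intro divide_right_mono card_count_cube) auto
      also have "\<dots> = (2 * r + 1 / sqrt (f n)) ^ ?k"
        by (simp only: eq power_divide)
      finally show ?case .
    qed
  qed
  \<comment> \<open>One \<epsilon> comes from the density, the other from the error term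
    \<open>\<epsilon> * v\<close>, which is proportional to the volume so that it survives division
    by \<open>?w n\<close> as a multiple of \<epsilon>.\<close>
  have upper: "\<forall>\<^sub>F n in F. measure_pmf.prob (U n) {m. ?X n m \<in> {y. \<forall>i. \<bar>y $ i\<bar> \<le> r}} < (\<phi> + 2 * \<epsilon>) * v"
  proof -
    have "closed {y :: real ^ 'k. \<forall>i. \<bar>y $ i\<bar> \<le> r}"
      by (intro closed_Collect_all closed_Collect_le continuous_intros)
    from gaussian_limit_closed[OF lim F this, of "\<epsilon> * v"] show ?thesis
    proof (rule eventually_mono)
      show "0 < \<epsilon> * v" using \<epsilon> v by simp
    qed (use mass[OF r(1,2)] in \<open>simp add: v_def algebra_simps\<close>)
  qed
  have lower: "\<forall>\<^sub>F n in F. (\<phi> - 2 * \<epsilon>) * v < measure_pmf.prob (U n) {m. ?X n m \<in> {y. \<forall>i. \<bar>y $ i\<bar> < r}}"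
  proof -
    have "open (\<Inter>i. {y :: real ^ 'k. \<bar>y $ i\<bar> < r})"
      by (intro open_INT ballI open_Collect_less continuous_intros) auto
    also have "(\<Inter>i. {y :: real ^ 'k. \<bar>y $ i\<bar> < r}) = {y. \<forall>i. \<bar>y $ i\<bar> < r}" by auto
    finally have "open {y :: real ^ 'k. \<forall>i. \<bar>y $ i\<bar> < r}" .
    from gaussian_limit_open[OF lim F this, of "\<epsilon> * v"] show ?thesis
    proof (rule eventually_mono)
      show "0 < \<epsilon> * v" using \<epsilon> v by simp
    qed (use mass[OF r(1,2)] in \<open>simp add: v_def algebra_simps\<close>)
  qed
  have up_lim: "\<forall>\<^sub>F n in F. (\<phi> + 2 * \<epsilon>) * v / ?w n < \<phi> + 3 * \<epsilon>"
    using v \<epsilon> by (intro order_tendstoD(2)[OF tendsto_divide[OF tendsto_const w]]) auto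
  have low_lim: "\<forall>\<^sub>F n in F. \<phi> - 3 * \<epsilon> < (\<phi> - 2 * \<epsilon>) * v / ?w n"
    using v \<epsilon> by (intro order_tendstoD(1)[OF tendsto_divide[OF tendsto_const w]]) auto
  have w_pos: "\<forall>\<^sub>F n in F. 0 < ?w n" using order_tendstoD(1)[OF w v] .
  show "\<forall>\<^sub>F n in F. dist (f n powr (real ?k / 2) * pmf (U n) (t n))
          (1 / ((2 * pi) powr (real ?k / 2) * sqrt (det V))) < e"
    using upper lower up_lim low_lim w_pos big mean f reg' t
  proof eventually_elim
    case (elim n)
    let ?s = "sqrt (f n)"
    let ?P = "measure_pmf.prob (U n) (?Q n)"
    define q where "q = f n powr (real ?k / 2) * pmf (U n) (t n)"
    have s: "0 < ?s" using elim(8) by simp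
    have pw: "f n powr (real ?k / 2) = ?s ^ ?k" using elim(8) by (rule powr_half_eq_sqrt_power)
    have "\<bar>(1 / ?s) * d\<bar> \<le> r \<longleftrightarrow> \<bar>d\<bar> \<le> r * ?s" for d
      using s by (simp add: abs_mult pos_divide_le_eq)
    then have Q_eq: "{m. ?X n m \<in> {y. \<forall>i. \<bar>y $ i\<bar> \<le> r}} = ?Q n"
      by (simp only: mem_Collect_eq vector_scaleR_component vector_minus_component rvec_def
          vec_lambda_beta real_scaleR_def)
    have up: "?P < (\<phi> + 2 * \<epsilon>) * v" using elim(1) unfolding Q_eq .
    have "{m. ?X n m \<in> {y. \<forall>i. \<bar>y $ i\<bar> < r}} \<subseteq> ?Q n"
      unfolding Q_eq[symmetric] by (auto intro: less_imp_le)
    then have "measure_pmf.prob (U n) {m. ?X n m \<in> {y. \<forall>i. \<bar>y $ i\<bar> < r}} \<le> ?P"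
      by (rule measure_pmf.finite_measure_mono) simp
    then have low: "(\<phi> - 2 * \<epsilon>) * v < ?P"
      using elim(2) by linarith
    have fin: "finite (?Q n)" using elim by (intro card_count_cube) auto
    have near: "norm (rvec m - mean_vec (U n)) \<le> \<delta>1 * ?s" if "m \<in> ?Q n" for m
    proof -
      have "norm (rvec m - mean_vec (U n)) \<le> (\<Sum>i\<in>UNIV. \<bar>(rvec m - mean_vec (U n)) $ i\<bar>)"
        by (rule norm_le_l1_cart)
      also have "\<dots> \<le> (\<Sum>i\<in>(UNIV :: 'k set). r * ?s)"
        by (rule sum_mono) (use that in \<open>simp add: rvec_def\<close>)
      also have "\<dots> = (real ?k * r) * ?s" by simp
      also have "\<dots> \<le> \<delta>1 * ?s" using r(3) s by (intro mult_right_mono) auto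
      finally show ?thesis .
    qed
    have tQ: "t n \<in> ?Q n"
    proof -
      have "\<bar>real (t n $ i) - mean_vec (U n) $ i\<bar> \<le> r * ?s" for i
        using elim(10)[rule_format, of i] elim(6) by linarith
      then show ?thesis by simp
    qed
    have P: "?P = (\<Sum>m\<in>?Q n. pmf (U n) m)"
      using fin by (rule measure_measure_pmf_finite)
    \<comment> \<open>The mass of the cube is compared with what it would be if every point had the
      mass of \<open>t n\<close>; regularity bounds each summand by \<epsilon>. Dividing by the
      number of points then isolates \<open>q\<close>.\<close>
    have "?s ^ ?k * ?P - real (card (?Q n)) * q
        = (\<Sum>m\<in>?Q n. ?s ^ ?k * (pmf (U n) m - pmf (U n) (t n)))"
      unfolding P q_def pw by (simp add: right_diff_distrib sum_subtractf sum_distrib_left)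
    then have "\<bar>?s ^ ?k * ?P - real (card (?Q n)) * q\<bar>
        = \<bar>\<Sum>m\<in>?Q n. ?s ^ ?k * (pmf (U n) m - pmf (U n) (t n))\<bar>"
      by (simp only:)
    also have "\<dots> \<le> (\<Sum>m\<in>?Q n. \<bar>?s ^ ?k * (pmf (U n) m - pmf (U n) (t n))\<bar>)"
      by (rule sum_abs)
    also have "\<dots> \<le> (\<Sum>m\<in>?Q n. \<epsilon>)"
    proof (rule sum_mono)
      fix m assume "m \<in> ?Q n"
      then show "\<bar>?s ^ ?k * (pmf (U n) m - pmf (U n) (t n))\<bar> \<le> \<epsilon>"
        using elim(9) near[OF tQ] near[of m] s unfolding pw by (simp add: abs_mult)
    qed
    finally have close: "\<bar>?s ^ ?k * ?P - real (card (?Q n)) * q\<bar> \<le> real (card (?Q n)) * \<epsilon>" by simp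
    define w where "w = ?w n"
    have N: "real (card (?Q n)) = w * ?s ^ ?k" using s by (simp add: w_def)
    have sk: "0 < ?s ^ ?k" using s by simp
    have "\<bar>?s ^ ?k * (?P - w * q)\<bar> \<le> ?s ^ ?k * (w * \<epsilon>)"
      using close unfolding N by (simp add: algebra_simps)
    then have "\<bar>?P - w * q\<bar> \<le> w * \<epsilon>"
      using sk by (simp only: abs_mult abs_of_pos mult_le_cancel_left_pos)
    moreover have "\<bar>p / w - q\<bar> \<le> \<epsilon>" if "0 < w" "\<bar>p - w * q\<bar> \<le> w * \<epsilon>" for p
    proof -
      have "p / w - q = (p - w * q) / w" using that(1) by (simp add: diff_divide_distrib)
      then show ?thesis using that by (simp add: abs_divide pos_divide_le_eq mult.commute)
    qed
    ultimately have "\<bar>?P / ?w n - q\<bar> \<le> \<epsilon>" using elim(5) unfolding w_def by blast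
    moreover have "?P / ?w n < \<phi> + 3 * \<epsilon>"
      using divide_strict_right_mono[OF up elim(5)] elim(3) by linarith
    moreover have "\<phi> - 3 * \<epsilon> < ?P / ?w n"
      using divide_strict_right_mono[OF low elim(5)] elim(4) by linarith
    ultimately have "\<bar>q - \<phi>\<bar> < e" using \<epsilon> by linarith
    then show ?case by (simp add: q_def \<phi>_def dist_real_def)
  qed
qed

section \<open>Determinants and covariance matrices\<close>

lemma det_scaleR:
  fixes A :: "real ^ 'k::finite ^ 'k"
  shows "det (c *\<^sub>R A) = c ^ CARD('k) * det A"
proof -
  have "c *\<^sub>R A = (\<chi> i. c *s (A $ i))" by (simp add: vec_eq_iff)
  then show ?thesis using det_rows_mul[of "\<lambda>_. c" "\<lambda>i. A $ i"] by simp
qed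

lemma tendsto_det:
  fixes A :: "real ^ 'k::finite ^ 'k"
  assumes "(X \<longlongrightarrow> A) F"
  shows "((\<lambda>n. det (X n)) \<longlongrightarrow> det A) F"
  unfolding det_def by (intro tendsto_intros assms)

text \<open>On the segment from the identity to \<open>A\<close> the matrices before \<open>A\<close> are positive definite, so the
  determinant, which is 1 at the identity, cannot change sign.\<close>

lemma det_pos_of_psd:
  fixes A :: "real ^ 'k::finite ^ 'k"
  assumes psd: "\<And>y. 0 \<le> y \<bullet> (A *v y)" and nz: "det A \<noteq> 0"
  shows "0 < det A"
proof (rule ccontr)
  assume "\<not> 0 < det A"
  let ?M = "\<lambda>s :: real. (1 - s) *\<^sub>R mat 1 + s *\<^sub>R A"
  have "continuous_on {0..1} (\<lambda>s. det (?M s))"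
    unfolding continuous_on_def by (intro ballI tendsto_det tendsto_intros)
  moreover have "det (?M 1) \<le> 0" "0 \<le> det (?M 0)" using \<open>\<not> 0 < det A\<close> by auto
  ultimately obtain s where s: "0 \<le> s" "s \<le> 1" "det (?M s) = 0"
    using IVT2'[of "\<lambda>s. det (?M s)" 1 0 0] by auto
  with nz have "s < 1" by (cases "s = 1") auto
  obtain y where y: "y \<noteq> 0" "?M s *v y = 0"
    using s(3) matrix_nonfull_linear_equations_eq[of "?M s"] det_eq_0_rank[of "?M s"] by auto
  have "y \<bullet> (?M s *v y) = (1 - s) * (y \<bullet> y) + s * (y \<bullet> (A *v y))"
    by (simp add: matrix_vector_mult_add_rdistrib scaleR_matrix_vector_assoc[symmetric] inner_add_right)
  moreover have "0 < (1 - s) * (y \<bullet> y)" using \<open>s < 1\<close> y(1) by simp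
  moreover have "0 \<le> s * (y \<bullet> (A *v y))" using s(1) psd by simp
  ultimately show False using y(2) by simp
qed

text \<open>The quadratic form is the variance of the linear combination of the counts with
  coefficients \<open>y\<close>. Finite support makes everything integrable, so expectation and
  double sum commute.\<close>

lemma cov_mat_psd:
  fixes U :: "(nat ^ 'k::finite) pmf"
  assumes fin: "finite (set_pmf U)"
  shows "0 \<le> y \<bullet> (cov_mat U *v y)"
proof -
  let ?d = "\<lambda>m i. real (m $ i) - mean_vec U $ i"
  have int: "integrable (measure_pmf U) g" for g :: "nat ^ 'k \<Rightarrow> real"
    using fin by (rule integrable_measure_pmf_finite)
  have "y \<bullet> (cov_mat U *v y) =
      (\<Sum>i\<in>UNIV. \<Sum>j\<in>UNIV. measure_pmf.expectation U (\<lambda>m. (y $ i * ?d m i) * (y $ j * ?d m j)))"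
    by (simp add: inner_vec_def matrix_vector_mult_def cov_mat_def sum_distrib_left mult_ac
        flip: integral_mult_right_zero)
  also have "\<dots> = measure_pmf.expectation U
      (\<lambda>m. (\<Sum>i\<in>UNIV. \<Sum>j\<in>UNIV. (y $ i * ?d m i) * (y $ j * ?d m j)))"
    by (simp add: int)
  also have "\<dots> = measure_pmf.expectation U (\<lambda>m. (\<Sum>i\<in>UNIV. y $ i * ?d m i)\<^sup>2)"
    by (simp add: power2_eq_square sum_product)
  also have "0 \<le> \<dots>" by (rule Bochner_Integration.integral_nonneg) simp
  finally show ?thesis .
qed

section \<open>The Boltzmann rejection sampler\<close>

lemma finite_set_count_law:
  fixes L :: "'a::finite list set"
  assumes \<pi>: "\<forall>i. 0 < \<pi> $ i" and ne: "words_of_length L n \<noteq> {}"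
  shows "finite (set_pmf (count_law L Z \<pi> n))"
proof -
  have "set_pmf (fixed_length_pmf L Z \<pi> n) \<subseteq> words_of_length L n"
    by (auto simp: set_pmf_eq pmf_fixed_length[OF \<pi> ne])
  then show ?thesis
    unfolding count_law_def using finite_subset finite_words_of_length by fastforce
qed

text \<open>All words of length \<open>n\<close> share the Boltzmann factor
  \<open>x ^ n / gen_fun L Z \<pi> x\<close>. It cancels in the ratio of the probabilities of length
  \<open>n\<close> and of acceptance, leaving the fixed-length law.\<close>

lemma expected_trials_eq:
  fixes L :: "'a::finite list set"
  assumes x: "0 < x" and \<pi>: "\<forall>i. 0 < \<pi> $ i"
    and sm: "(\<lambda>w. weight Z \<pi> w * x ^ length w) summable_on L"
    and ne: "words_of_length L n \<noteq> {}" and pos: "0 < pmf (count_law L Z \<pi> n) t"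
  shows "expected_trials L Z \<pi> x n t = ennreal (1 / pmf (count_law L Z \<pi> n) t)"
proof -
  let ?W = "words_of_length L n" and ?p = "boltzmann L Z \<pi> x" and ?G = "gen_fun L Z \<pi> x"
  let ?S = "\<Sum>v\<in>words_of_length L n. weight Z \<pi> v"
  let ?A = "{w. accepts Z n t w}" and ?B = "{w. length w = n}"
  let ?c = "(\<Prod>i\<in>UNIV. (\<pi> $ i) ^ (t $ i)) * real (card {w \<in> ?W. letter_counts Z w = t})"
  have fin: "finite ?W" by (rule finite_words_of_length)
  have "L \<noteq> {}" using ne by (auto simp: words_of_length_def)
  note pmf = pmf_boltzmann[OF x \<pi> sm this]
  \<comment> \<open>A zero normaliser would make every probability 0, by division by zero, but a
    \<open>pmf\<close> has nonempty support. Its sign then follows from nonnegativity of a single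
    probability.\<close>
  have "?G \<noteq> 0"
  proof
    assume "?G = 0"
    then have "set_pmf ?p = {}" by (auto simp: set_pmf_eq pmf)
    then show False by (simp add: set_pmf_not_empty)
  qed
  obtain w where "w \<in> L" using \<open>L \<noteq> {}\<close> by blast
  then have "0 \<le> weight Z \<pi> w * x ^ length w / ?G" using pmf[of w] pmf_nonneg[of ?p w] by simp
  moreover have "0 < weight Z \<pi> w * x ^ length w" using weight_pos[OF \<pi>, of Z w] x by simp
  ultimately have G: "0 < ?G" using \<open>?G \<noteq> 0\<close> by (simp add: zero_le_divide_iff)
  have prob: "measure_pmf.prob ?p D = (\<Sum>w\<in>{w\<in>?W. w \<in> D}. weight Z \<pi> w) * x ^ n / ?G"
    if "\<And>w. w \<in> D \<Longrightarrow> length w = n" for D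
  proof -
    have "measure_pmf.prob ?p D = measure_pmf.prob ?p {w\<in>?W. w \<in> D}"
      by (rule measure_prob_cong_0) (use that in \<open>auto simp: pmf words_of_length_def\<close>)
    also have "\<dots> = (\<Sum>w\<in>{w\<in>?W. w \<in> D}. pmf ?p w)"
      using fin by (intro measure_measure_pmf_finite) simp
    also have "\<dots> = (\<Sum>w\<in>{w\<in>?W. w \<in> D}. weight Z \<pi> w * (x ^ n / ?G))"
      by (intro sum.cong) (auto simp: pmf words_of_length_def)
    finally show ?thesis by (simp add: sum_distrib_right sum_divide_distrib)
  qed
  have B: "measure_pmf.prob ?p ?B = ?S * x ^ n / ?G"
  proof -
    have "{w \<in> ?W. w \<in> ?B} = ?W" by (auto simp: words_of_length_def)
    then show ?thesis using prob[of ?B] by simp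
  qed
  have A: "measure_pmf.prob ?p ?A = ?c * x ^ n / ?G"
  proof -
    have "{w \<in> ?W. w \<in> ?A} = {w \<in> ?W. letter_counts Z w = t}"
      by (auto simp: words_of_length_def accepts_def)
    moreover have "(\<Sum>w\<in>{w \<in> ?W. letter_counts Z w = t}. weight Z \<pi> w)
        = (\<Sum>w\<in>{w \<in> ?W. letter_counts Z w = t}. \<Prod>i\<in>UNIV. (\<pi> $ i) ^ (t $ i))"
      by (intro sum.cong) (auto simp: weight_def letter_counts_def)
    ultimately show ?thesis using prob[of ?A] by (simp add: accepts_def)
  qed
  have S: "0 < ?S" using fin ne by (intro sum_pos weight_pos[OF \<pi>]) auto
  have law: "pmf (count_law L Z \<pi> n) t = ?c / ?S" by (rule pmf_count_law[OF \<pi> ne])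
  with pos S have c: "0 < ?c" by (simp add: zero_less_divide_iff)
  have "?A \<subseteq> ?B" by (auto simp: accepts_def)
  moreover have "0 < measure_pmf.prob ?p ?A" unfolding A using c x G by simp
  ultimately have "expected_trials L Z \<pi> x n t
      = ennreal (measure_pmf.prob ?p ?B / measure_pmf.prob ?p ?A)"
    unfolding expected_trials_def num_trials_def
    using nn_integral_draws_until[of ?A ?B ?p] by (simp only: mem_Collect_eq)
  also have "measure_pmf.prob ?p ?B / measure_pmf.prob ?p ?A = ?S / ?c"
    unfolding A B using x G by simp
  finally show ?thesis by (simp add: law)
qed

theorem theorem4:
  fixes L :: "'a::finite list set"
    and Z :: "'k::finite \<Rightarrow> 'a"
    and a :: "nat \<Rightarrow> real ^ 'k"
    and x :: "nat \<Rightarrow> real"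
    and \<pi> :: "nat \<Rightarrow> real ^ 'k"
    and f :: "nat \<Rightarrow> real"
    and V\<^sub>0 :: "real ^ 'k ^ 'k"
    and t :: "nat \<Rightarrow> nat ^ 'k"
  defines "F \<equiv> lengths_at_top L"
    and "U \<equiv> \<lambda>n. count_law L Z (\<pi> n) n"
  defines "\<mu> \<equiv> \<lambda>n. mean_vec (U n)"
    and "V \<equiv> \<lambda>n. cov_mat (U n)"
  assumes cf: "context_free L"
    and letters: "inj Z"
    and a_pos: "\<And>n i. 0 < a n $ i"
    and tuned: "\<forall>\<^sub>F n in F. tuned L Z n (a n) (x n) (\<pi> n)"
    and f_pos: "\<forall>\<^sub>F n in F. 0 < f n"
    and V_prop: "((\<lambda>n. (1 / f n) *\<^sub>R V n) \<longlongrightarrow> V\<^sub>0) F"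
    and nondegenerate: "invertible V\<^sub>0"
    and gauss: "gaussian_limit F U f V\<^sub>0"
    and regular: "locally_regular F U f"
    and target: "\<forall>\<^sub>F n in F. \<forall>i. \<bar>real (t n $ i) - \<mu> n $ i\<bar> < 1"
  shows "(\<lambda>n. enn2real (expected_trials L Z (\<pi> n) (x n) n (t n)))
           \<sim>[F] (\<lambda>n. (2 * pi) powr (real CARD('k) / 2) * sqrt (det (V n))) \<and>
         (\<lambda>n. (2 * pi) powr (real CARD('k) / 2) * sqrt (det (V n)))
           \<in> \<Theta>[F](\<lambda>n. f n powr (real CARD('k) / 2)) \<and>
         (\<forall>\<^sub>F n in F. expected_trials L Z (\<pi> n) (x n) n (t n) < \<infinity>)"
proof (cases "F = bot")
  case True
  have "(\<lambda>n. (2 * pi) powr (real CARD('k) / 2) * sqrt (det (V n)))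
      \<in> \<Theta>[F](\<lambda>n. f n powr (real CARD('k) / 2))"
    by (rule bigthetaI_tendsto[of 1]) (simp_all add: True)
  then show ?thesis by (simp add: True asymp_equiv_def)
next
  case F: False
  let ?c = "(2 * pi) powr (real CARD('k) / 2)" and ?g = "\<lambda>n. f n powr (real CARD('k) / 2)"
  let ?E = "\<lambda>n. expected_trials L Z (\<pi> n) (x n) n (t n)" and ?W = "\<lambda>n. ?c * sqrt (det (V n))"
  have ne: "\<forall>\<^sub>F n in F. words_of_length L n \<noteq> {}"
    by (simp add: F_def lengths_at_top_def eventually_inf_principal)
  have psd: "\<forall>\<^sub>F n in F. \<forall>y. 0 \<le> y \<bullet> (V n *v y)"
    using ne tuned
  proof eventually_elim
    case (elim n)
    then have "\<forall>i. 0 < \<pi> n $ i" by (simp add: tuned_def)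
    then have "finite (set_pmf (U n))" using elim(1) unfolding U_def by (intro finite_set_count_law)
    then show ?case unfolding V_def by (auto intro: cov_mat_psd)
  qed
  have "0 \<le> y \<bullet> (V\<^sub>0 *v y)" for y
  proof (rule tendsto_lowerbound[OF _ _ F])
    show "((\<lambda>n. y \<bullet> (((1 / f n) *\<^sub>R V n) *v y)) \<longlongrightarrow> y \<bullet> (V\<^sub>0 *v y)) F"
      unfolding matrix_vector_mult_def inner_vec_def vec_lambda_beta
      by (intro tendsto_intros tendsto_vec_nth V_prop)
    show "\<forall>\<^sub>F n in F. 0 \<le> y \<bullet> (((1 / f n) *\<^sub>R V n) *v y)"
      using psd f_pos by eventually_elim (simp flip: scaleR_matrix_vector_assoc)
  qed
  \<comment> \<open>Invertibility alone would allow a negative determinant; semidefiniteness,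
    inherited from the covariance matrices in the limit, excludes it.\<close>
  then have det: "0 < det V\<^sub>0"
    using nondegenerate by (intro det_pos_of_psd) (simp_all add: invertible_det_nz)
  \<comment> \<open>The determinant is homogeneous of degree \<open>k\<close>, so the factor
    \<open>1 / f n\<close> inside it leaves the square root as
    \<open>1 / f n powr (k / 2)\<close>.\<close>
  have W: "((\<lambda>n. ?W n / ?g n) \<longlongrightarrow> ?c * sqrt (det V\<^sub>0)) F"
  proof (rule Lim_transform_eventually)
    show "((\<lambda>n. ?c * sqrt (det ((1 / f n) *\<^sub>R V n))) \<longlongrightarrow> ?c * sqrt (det V\<^sub>0)) F"
      by (intro tendsto_intros tendsto_det V_prop)
    show "\<forall>\<^sub>F n in F. ?c * sqrt (det ((1 / f n) *\<^sub>R V n)) = ?W n / ?g n"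
      using f_pos
      by eventually_elim
        (simp add: det_scaleR powr_half_eq_sqrt_power real_sqrt_mult real_sqrt_divide real_sqrt_power power_divide)
  qed
  have c: "0 < ?c * sqrt (det V\<^sub>0)" using det by simp
  have local: "((\<lambda>n. ?g n * pmf (U n) (t n)) \<longlongrightarrow> 1 / (?c * sqrt (det V\<^sub>0))) F"
    using target unfolding \<mu>_def by (rule local_limit[OF gauss regular F det f_pos])
  \<comment> \<open>The local limit is positive, so eventually the target has positive probability;
    this is what keeps the expected number of trials finite.\<close>
  have E: "\<forall>\<^sub>F n in F. ?E n = ennreal (1 / pmf (U n) (t n))"
  proof -
    have "\<forall>\<^sub>F n in F. 0 < ?g n * pmf (U n) (t n)"
      using c by (intro order_tendstoD(1)[OF local]) simp
    with ne tuned show ?thesis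
    proof eventually_elim
      case (elim n)
      then have "0 < pmf (U n) (t n)" by (simp add: zero_less_mult_iff)
      with elim show ?case unfolding U_def tuned_def by (intro expected_trials_eq) auto
    qed
  qed
  have "((\<lambda>n. enn2real (?E n) / ?W n) \<longlongrightarrow> 1) F"
  proof (rule Lim_transform_eventually)
    \<comment> \<open>The limits of \<open>?g n * pmf (U n) (t n)\<close> and of
      \<open>?W n / ?g n\<close> are reciprocal, and the powers of \<open>f n\<close> cancel in
      their product, which is \<open>?W n\<close> divided by the expected number of trials.\<close>
    have one: "1 / (1 / (?c * sqrt (det V\<^sub>0)) * (?c * sqrt (det V\<^sub>0))) = 1"
      using det by simp
    have "((\<lambda>n. 1 / ((?g n * pmf (U n) (t n)) * (?W n / ?g n))) \<longlongrightarrow>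
        1 / (1 / (?c * sqrt (det V\<^sub>0)) * (?c * sqrt (det V\<^sub>0)))) F"
      using det by (intro tendsto_divide tendsto_mult[OF local W] tendsto_const) simp
    then show "((\<lambda>n. 1 / ((?g n * pmf (U n) (t n)) * (?W n / ?g n))) \<longlongrightarrow> 1) F"
      unfolding one .
    show "\<forall>\<^sub>F n in F. 1 / ((?g n * pmf (U n) (t n)) * (?W n / ?g n)) = enn2real (?E n) / ?W n"
      using E f_pos
    proof eventually_elim
      case (elim n)
      have "0 < ?g n" using elim(2) by simp
      then have "(?g n * pmf (U n) (t n)) * (?W n / ?g n) = pmf (U n) (t n) * ?W n" by simp
      then show ?case unfolding elim(1) by simp
    qed
  qed
  then have "(\<lambda>n. enn2real (?E n)) \<sim>[F] ?W" by (rule asymp_equivI')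
  moreover have "?W \<in> \<Theta>[F](?g)" using det by (intro bigthetaI_tendsto[OF _ W]) simp
  moreover have "\<forall>\<^sub>F n in F. ?E n < \<infinity>" using E by eventually_elim simp
  ultimately show ?thesis by blast
qed

end
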